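(* Let $(X,V,W,S,\mathcal H_*,h,*,\Theta)$ satisfy the abstract symmetrization framework described in the context. Let $G_j:X\to\mathbb R$, $1\le j\le m$, be $C^1$ functions, let $1\le p\le m$ and let $$\mathscr C=\{u\in X:\ G_j(u)=0\text{ for }1\le j\le p\text{ and }G_j(u)\ge0\text{ for }p+1\le j\le m\}.$$ For $u\in\mathscr C$ let $\mathscr I(u)=\{j: G_j(u)=0\}$. Assume that: (i) $f:X\to\mathbb R$ is Fréchet differentiable and $-\infty<\inf_{\mathscr C}f<+\infty$; (ii) for all $u\in\mathscr C$ there exists $\xi\in\mathscr C\cap S$ such that $f(\xi)\le f(u)$; (iii) for all $u\in\mathscr C$ the elements $\{dG_j(u)\}_{j\in\mathscr I(u)}$ are linearly independent in $X'$; (iv) for all $u\in\mathscr C\cap S$ and all $H\in\mathcal H_*$, $u^H\in\mathscr C$ and $f(u^H)\le f(u)$. Then there is a constant $C>0$ such that for every $\varepsilon>0$ there exists $u_\varepsilon\in\mathscr C$ such that $$f(u_\varepsilon)\le\inf_{\mathscr C}f+\varepsilon^2,\qquad \|u_\varepsilon-u_\varepsilon^*\|_V<C\varepsilon,\qquad \Big\|df(u_\varepsilon)-\sum_{j=1}^m\lambda_j\,dG_j(u_\varepsilon)\Big\|_{X'}\le\varepsilon,$$ for some $\lambda_j\in\mathbb R$, $1\le j\le m$, such that $\lambda_j\ge0$ for $p+1\le j\le m$ and $\lambda_j=0$ if $G_j(u_\varepsilon)\ne0$.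
   Context: Abstract framework. $X,V,W$ are real Banach spaces with $X\subseteq V\subseteq W$, $X$ continuously embedded in $V$ and $V$ continuously embedded in $W$; $\|\cdot\|$ is the norm of $X$, $X'$ its topological dual. $S\subseteq X$ carries the metric induced by $\|\cdot\|$, $\mathcal H_*$ is a path-connected topological space, and there are maps $*:S\to S$, $u\mapsto u^*$ (symmetrization) and $h:S\times\mathcal H_*\to S$, $(u,H)\mapsto u^H$ (polarization) such that: $h$ is continuous; $(u^* )^H=(u^H)^*=u^*$ and $(u^H)^H=u^H$ for all $u\in S$, $H\in\mathcal H_*$; there is a sequence $(H_m)\subset\mathcal H_*$ such that for every $u\in S$ the iterated polarizations $u^{H_1\cdots H_m}$ converge to $u^*$ in $V$ as $m\to\infty$; $\|u^H-v^H\|_V\le\|u-v\|_V$ for all $u,v\in S$, $H\in\mathcal H_*$. Moreover $\Theta:(X,\|\cdot\|_V)\to(S,\|\cdot\|_V)$ is Lipschitz with constant $C_\Theta>0$ and $\Theta|_S=\mathrm{Id}|_S$; for $u\in X$ one sets $u^H:=(\Theta(u))^H$ and $u^*:=(\Theta(u))^*$. *)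

theory Defs
  imports "HOL-Analysis.Analysis"
begin

text \<open>Iterated polarization: \<open>iter_pol h H n u\<close> is \<open>(\<dots>(u\<^sup>H\<^sup>1)\<dots>)\<^sup>H\<^sup>n\<close>; the sequence of
  polarizers starts at index 1.\<close>

primrec iter_pol :: "('x \<Rightarrow> 'h \<Rightarrow> 'x) \<Rightarrow> (nat \<Rightarrow> 'h) \<Rightarrow> nat \<Rightarrow> 'x \<Rightarrow> 'x" where
  "iter_pol h H 0 u = u"
| "iter_pol h H (Suc n) u = h (iter_pol h H n u) (H (Suc n))"

text \<open>The inclusions \<open>X \<subseteq> V \<subseteq> W\<close> are the injective bounded linear maps \<open>\<iota>\<close> and \<open>\<kappa>\<close>, so the
  \<open>V\<close>-norm of \<open>u\<close> in \<open>X\<close> is \<open>norm (\<iota> u)\<close>. The space of polarizers is the topological space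
  \<open>\<H>\<close>; \<open>pol u H\<close> and \<open>star u\<close> matter only for \<open>u \<in> S\<close> and \<open>H \<in> topspace \<H>\<close>.\<close>

locale symmetrization_framework =
  fixes \<iota> :: "'x::banach \<Rightarrow> 'v::banach"
    and \<kappa> :: "'v \<Rightarrow> 'w::banach"
    and S :: "'x set"
    and \<H> :: "'h topology"
    and pol :: "'x \<Rightarrow> 'h \<Rightarrow> 'x"
    and star :: "'x \<Rightarrow> 'x"
    and \<Theta> :: "'x \<Rightarrow> 'x"
    and C\<^sub>\<Theta> :: real
  assumes embed_XV: "bounded_linear \<iota>" "inj \<iota>"
    and embed_VW: "bounded_linear \<kappa>" "inj \<kappa>"
    and path_connected: "path_connected_space \<H>"
    and star_in: "\<And>u. u \<in> S \<Longrightarrow> star u \<in> S"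
    and pol_in: "\<And>u H. u \<in> S \<Longrightarrow> H \<in> topspace \<H> \<Longrightarrow> pol u H \<in> S"
    and pol_continuous:
      "continuous_map (prod_topology (top_of_set S) \<H>) (top_of_set S) (\<lambda>(u, H). pol u H)"
    and pol_star: "\<And>u H. u \<in> S \<Longrightarrow> H \<in> topspace \<H> \<Longrightarrow> pol (star u) H = star u"
    and star_pol: "\<And>u H. u \<in> S \<Longrightarrow> H \<in> topspace \<H> \<Longrightarrow> star (pol u H) = star u"
    and pol_pol: "\<And>u H. u \<in> S \<Longrightarrow> H \<in> topspace \<H> \<Longrightarrow> pol (pol u H) H = pol u H"
    and iter_pol_tendsto:
      "\<exists>H. (\<forall>n\<ge>1. H n \<in> topspace \<H>) \<and>
         (\<forall>u\<in>S. (\<lambda>n. \<iota> (iter_pol pol H n u)) \<longlonglongrightarrow> \<iota> (star u))"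
    and pol_nonexpansive:
      "\<And>u v H. u \<in> S \<Longrightarrow> v \<in> S \<Longrightarrow> H \<in> topspace \<H> \<Longrightarrow>
         norm (\<iota> (pol u H) - \<iota> (pol v H)) \<le> norm (\<iota> u - \<iota> v)"
    and \<Theta>_in: "\<And>u. \<Theta> u \<in> S"
    and \<Theta>_id: "\<And>u. u \<in> S \<Longrightarrow> \<Theta> u = u"
    and C\<^sub>\<Theta>_pos: "C\<^sub>\<Theta> > 0"
    and \<Theta>_lipschitz: "\<And>u v. norm (\<iota> (\<Theta> u) - \<iota> (\<Theta> v)) \<le> C\<^sub>\<Theta> * norm (\<iota> u - \<iota> v)"

text \<open>Extension of \<open>pol\<close> and \<open>star\<close> from \<open>S\<close> to all of \<open>X\<close>.\<close>

definition pol_ext :: "('x \<Rightarrow> 'h \<Rightarrow> 'x) \<Rightarrow> ('x \<Rightarrow> 'x) \<Rightarrow> 'x \<Rightarrow> 'h \<Rightarrow> 'x" where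
  "pol_ext pol \<Theta> u H = pol (\<Theta> u) H"

definition star_ext :: "('x \<Rightarrow> 'x) \<Rightarrow> ('x \<Rightarrow> 'x) \<Rightarrow> 'x \<Rightarrow> 'x" where
  "star_ext star \<Theta> u = star (\<Theta> u)"

text \<open>The Frechet differential as an element of the dual space; meaningful only where the
  function is differentiable.\<close>

definition differential :: "('x::real_normed_vector \<Rightarrow> real) \<Rightarrow> 'x \<Rightarrow> ('x \<Rightarrow>\<^sub>L real)" where
  "differential g u = Blinfun (frechet_derivative g (at u))"

definition C1_functional :: "('x::real_normed_vector \<Rightarrow> real) \<Rightarrow> bool" where
  "C1_functional g \<longleftrightarrow> (\<forall>u. g differentiable (at u)) \<and> continuous_on UNIV (differential g)"

definition constraint_set :: "(nat \<Rightarrow> 'x \<Rightarrow> real) \<Rightarrow> nat \<Rightarrow> nat \<Rightarrow> 'x set" where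
  "constraint_set G p m =
     {u. (\<forall>j\<in>{1..p}. G j u = 0) \<and> (\<forall>j\<in>{p+1..m}. G j u \<ge> 0)}"

definition active_indices :: "(nat \<Rightarrow> 'x \<Rightarrow> real) \<Rightarrow> nat \<Rightarrow> 'x \<Rightarrow> nat set" where
  "active_indices G m u = {j\<in>{1..m}. G j u = 0}"

text \<open>Linear independence of an indexed family: repeated members are not allowed.\<close>

definition independent_family :: "('i \<Rightarrow> 'a::real_vector) \<Rightarrow> 'i set \<Rightarrow> bool" where
  "independent_family b I \<longleftrightarrow> inj_on b I \<and> independent (b ` I)"

end

theory Submission
  imports Defs
begin

text \<open>Iterated polarization turns an almost minimizer in \<open>S\<close> into one that is also close in \<open>V\<close> to
  its symmetrization \<open>u\<^sup>*\<close>, since \<open>u\<^sup>*\<close> does not change along the iteration. Ekeland's principle on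
  the closed set \<open>\<C>\<close> moves this point by at most \<open>\<epsilon>\<close>, and \<open>u \<mapsto> u\<^sup>*\<close> is Lipschitz in \<open>V\<close>, so the new
  point \<open>v\<close> is still almost symmetric. A Lyusternik-type argument gives \<open>df(v) h \<ge> -\<epsilon> \<parallel>h\<parallel>\<close> on the
  linearized cone at \<open>v\<close>; the Hahn-Banach theorem replaces \<open>df(v)\<close> by an \<open>\<epsilon>\<close>-close functional that is
  nonnegative on that cone, and such a functional is a combination of the active \<open>dG\<^sub>j(v)\<close> because
  these have a dual family.\<close>


section \<open>Ekeland's variational principle\<close>

text \<open>\<open>S x\<close> collects the points of \<open>C\<close> whose gain over
  \<open>x\<close> pays for the distance at rate \<open>\<epsilon>\<close>; membership is
  transitive. Passing repeatedly to a near-minimizer of \<open>f\<close> on the current set gives a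
  Cauchy sequence whose limit belongs to every \<open>S (x n)\<close>, so that no further paid
  descent is possible from it.\<close>

lemma ekeland_variational_principle:
  fixes f :: "'a::complete_space \<Rightarrow> real"
  assumes closed: "closed C" and cont: "continuous_on C f"
    and below: "bdd_below (f ` C)" and "w \<in> C" and "\<epsilon> > 0"
  obtains v where "v \<in> C" "f v + \<epsilon> * dist w v \<le> f w"
    "\<And>z. z \<in> C \<Longrightarrow> f v \<le> f z + \<epsilon> * dist v z"
proof -
  define S where "S x = {y \<in> C. f y + \<epsilon> * dist x y \<le> f x}" for x
  have S_refl: "x \<in> S x" if "x \<in> C" for x
    using that by (simp add: S_def)
  have S_trans: "z \<in> S x" if "y \<in> S x" "z \<in> S y" for x y z
  proof -
    have "\<epsilon> * dist x z \<le> \<epsilon> * dist x y + \<epsilon> * dist y z"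
      using dist_triangle[of x z y] \<open>\<epsilon> > 0\<close> by (simp flip: distrib_left)
    then show ?thesis
      using that by (auto simp: S_def)
  qed
  \<comment> \<open>The tolerance \<open>(1/2)^n\<close> serves only as some positive sequence
    tending to 0.\<close>
  have step: "\<exists>y. y \<in> C \<and> y \<in> S x \<and> (\<forall>z\<in>S x. f y \<le> f z + (1/2)^n)" if "x \<in> C" for x n
  proof -
    have bdd: "bdd_below (f ` S x)"
      by (rule bdd_below_mono[OF below]) (auto simp: S_def)
    have "(INF z\<in>S x. f z) < (INF z\<in>S x. f z) + (1/2)^n"
      by simp
    then obtain y where "y \<in> S x" "f y < (INF z\<in>S x. f z) + (1/2)^n"
      using bdd S_refl[OF \<open>x \<in> C\<close>] by (subst (asm) cINF_less_iff) auto
    moreover have "(INF z\<in>S x. f z) \<le> f z" if "z \<in> S x" for z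
      using bdd that by (rule cINF_lower)
    ultimately have "\<forall>z\<in>S x. f y \<le> f z + (1/2)^n"
      by fastforce
    then show ?thesis
      using \<open>y \<in> S x\<close> by (auto simp: S_def)
  qed
  obtain x where x: "\<And>n. x n \<in> C" "x 0 = w" and next_in: "\<And>n. x (Suc n) \<in> S (x n)"
    and near_inf: "\<And>n z. z \<in> S (x n) \<Longrightarrow> f (x (Suc n)) \<le> f z + (1/2)^n"
  proof -
    have "\<exists>x. \<forall>n. (x n \<in> C \<and> (n = 0 \<longrightarrow> x n = w)) \<and>
        (x (Suc n) \<in> S (x n) \<and> (\<forall>z\<in>S (x n). f (x (Suc n)) \<le> f z + (1/2)^n))"
      by (rule dependent_nat_choice) (use \<open>w \<in> C\<close> step in auto)
    then show ?thesis
      using that by blast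
  qed
  have tail: "x (n + k) \<in> S (x n)" for n k
    by (induction k) (use x S_refl S_trans next_in in auto)
  then have tail': "x k \<in> S (x n)" if "n \<le> k" for n k
    using that by (metis le_iff_add)
  have decr: "f (x k) \<le> f (x n)" if "n \<le> k" for n k
  proof -
    have "0 \<le> \<epsilon> * dist (x n) (x k)"
      using \<open>\<epsilon> > 0\<close> by simp
    then show ?thesis
      using tail'[OF that] by (auto simp: S_def)
  qed
  obtain B where B: "\<And>y. y \<in> C \<Longrightarrow> B \<le> f y"
    using below by (auto simp: bdd_below_def)
  obtain L where L: "(\<lambda>n. f (x n)) \<longlonglongrightarrow> L"
    by (rule decseq_convergent[of "\<lambda>n. f (x n)" B]) (use decr B x in \<open>auto simp: decseq_def\<close>)
  \<comment> \<open>The values \<open>f (x n)\<close> decrease and are bounded below, hence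
    converge; membership in \<open>S (x m)\<close> bounds \<open>\<epsilon>\<close> times a distance
    by a difference of these values.\<close>
  have "Cauchy x"
    unfolding Cauchy_altdef
  proof (intro allI impI)
    fix e :: real
    assume "e > 0"
    have "Cauchy (\<lambda>n. f (x n))"
      using L by (rule LIMSEQ_imp_Cauchy)
    then obtain M where M: "\<And>m n. m \<ge> M \<Longrightarrow> n > m \<Longrightarrow> dist (f (x m)) (f (x n)) < \<epsilon> * e"
      unfolding Cauchy_altdef using \<open>e > 0\<close> \<open>\<epsilon> > 0\<close> by (meson mult_pos_pos)
    have "dist (x m) (x n) < e" if "m \<ge> M" "n > m" for m n
    proof -
      have "\<epsilon> * dist (x m) (x n) \<le> f (x m) - f (x n)"
        using tail'[of m n] that by (auto simp: S_def)
      also have "\<dots> < \<epsilon> * e"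
        using M[OF that] by (simp add: dist_real_def)
      finally show ?thesis
        using \<open>\<epsilon> > 0\<close> by simp
    qed
    then show "\<exists>M. \<forall>m\<ge>M. \<forall>n>m. dist (x m) (x n) < e"
      by blast
  qed
  then obtain v where v: "x \<longlonglongrightarrow> v"
    using Cauchy_convergent convergent_def by blast
  have "v \<in> C"
    using closed_sequentially[OF closed _ v] x by blast
  have fv: "(\<lambda>n. f (x n)) \<longlonglongrightarrow> f v"
    using continuous_on_tendsto_compose[OF cont v \<open>v \<in> C\<close>] x by auto
  have vS: "v \<in> S (x n)" for n
  proof -
    have "(\<lambda>k. f (x k) + \<epsilon> * dist (x n) (x k)) \<longlonglongrightarrow> f v + \<epsilon> * dist (x n) v"
      by (intro tendsto_intros fv v)
    then have "f v + \<epsilon> * dist (x n) v \<le> f (x n)"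
      by (rule LIMSEQ_le_const2) (use tail' in \<open>auto simp: S_def\<close>)
    then show ?thesis
      using \<open>v \<in> C\<close> by (simp add: S_def)
  qed
  \<comment> \<open>A violating \<open>z\<close> would lie in \<open>S v\<close>, hence by
    transitivity in every \<open>S (x n)\<close>. The near-minimality of \<open>x (Suc n)\<close>
    then gives \<open>f v \<le> f z\<close> in the limit, although \<open>z\<close> was strictly
    better than \<open>v\<close>.\<close>
  have "f v \<le> f z + \<epsilon> * dist v z" if "z \<in> C" for z
  proof (rule ccontr)
    assume neg: "\<not> ?thesis"
    then have "z \<in> S v"
      using that by (simp add: S_def)
    then have "f (x (Suc n)) \<le> f z + (1/2)^n" for n
      using near_inf S_trans vS by blast
    moreover have "(\<lambda>n. f (x (Suc n))) \<longlonglongrightarrow> f v"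
      using fv by (rule LIMSEQ_Suc)
    moreover have "(\<lambda>n. f z + (1/2)^n) \<longlonglongrightarrow> f z + 0"
      by (intro tendsto_intros LIMSEQ_power_zero) simp
    ultimately have "f v \<le> f z + 0"
      by (intro LIMSEQ_le) auto
    then show False
      using neg \<open>\<epsilon> > 0\<close> by (smt (verit) mult_nonneg_nonneg zero_le_dist)
  qed
  then show thesis
    using that[of v] \<open>v \<in> C\<close> vS[of 0] x by (simp add: S_def)
qed

section \<open>Sublinear functionals and the Hahn-Banach theorem\<close>

text \<open>Homogeneity is only asked as an inequality for positive factors, which is what infima
  inherit directly. Equality follows by using the inverse factor as well.\<close>

definition sublinear_functional :: "('a::real_vector \<Rightarrow> real) \<Rightarrow> bool" where
  "sublinear_functional q \<longleftrightarrow>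
     (\<forall>x y. q (x + y) \<le> q x + q y) \<and> (\<forall>c>0. \<forall>x. q (c *\<^sub>R x) \<le> c * q x)"

lemma sublinear_functional_add:
  "sublinear_functional q \<Longrightarrow> q (x + y) \<le> q x + q y"
  by (simp add: sublinear_functional_def)

lemma sublinear_functional_scale_le:
  "sublinear_functional q \<Longrightarrow> c > 0 \<Longrightarrow> q (c *\<^sub>R x) \<le> c * q x"
  by (simp add: sublinear_functional_def)

lemma sublinear_functional_zero: "sublinear_functional q \<Longrightarrow> q 0 = 0"
  using sublinear_functional_scale_le[of q 2 0] sublinear_functional_scale_le[of q "1/2" 0]
  by simp

lemma sublinear_functional_scale:
  assumes "sublinear_functional q" "c \<ge> 0"
  shows "q (c *\<^sub>R x) = c * q x"
proof (cases "c = 0")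
  case False
  then have "c > 0"
    using assms by simp
  have "q (inverse c *\<^sub>R (c *\<^sub>R x)) \<le> inverse c * q (c *\<^sub>R x)"
    using assms \<open>c > 0\<close> by (intro sublinear_functional_scale_le) auto
  then have "c * q x \<le> q (c *\<^sub>R x)"
    using \<open>c > 0\<close> by (simp add: field_simps)
  then show ?thesis
    using sublinear_functional_scale_le[OF assms(1) \<open>c > 0\<close>, of x] by simp
qed (use assms sublinear_functional_zero in simp)

lemma sublinear_functional_minus:
  "sublinear_functional q \<Longrightarrow> - q (- x) \<le> q x"
  using sublinear_functional_add[of q x "- x"] sublinear_functional_zero[of q] by simp

text \<open>Zorn's lemma for the reversed pointwise order: the pointwise infimum of a nonempty chain
  is again sublinear.\<close>

lemma minimal_sublinear_functional_exists:
  assumes "sublinear_functional p"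
  obtains q where "sublinear_functional q" "q \<le> p"
    "\<And>r. sublinear_functional r \<Longrightarrow> r \<le> q \<Longrightarrow> r = q"
proof -
  define A where "A = {q. sublinear_functional q \<and> q \<le> p}"
  have "\<exists>q\<in>A. \<forall>r\<in>A. r \<le> q \<longrightarrow> r = q"
  proof (rule predicate_Zorn)
    show "partial_order_on A (relation_of (\<lambda>q r. r \<le> q) A)"
      by (auto simp: partial_order_on_def preorder_on_def refl_on_def trans_def antisym_def
          relation_of_def)
  next
    fix C
    assume "C \<in> Chains (relation_of (\<lambda>q r. r \<le> q) A)"
    then have C: "C \<subseteq> A" "\<And>q r. q \<in> C \<Longrightarrow> r \<in> C \<Longrightarrow> q \<le> r \<or> r \<le> q"
      by (auto simp: Chains_def relation_of_def)
    show "\<exists>u\<in>A. \<forall>a\<in>C. u \<le> a"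
    proof (cases "C = {}")
      case True
      then show ?thesis
        using assms by (auto simp: A_def)
    next
      case False
      define u where "u x = (INF q\<in>C. q x)" for x
      have sub: "sublinear_functional q" and le_p: "q \<le> p" if "q \<in> C" for q
        using that C by (auto simp: A_def)
      \<comment> \<open>This bound does not depend on \<open>q\<close>, so the pointwise infima are
        finite.\<close>
      have "- p (- x) \<le> q x" if "q \<in> C" for q x
        using sublinear_functional_minus[OF sub[OF that], of x] le_funD[OF le_p[OF that], of "- x"]
        by linarith
      then have bdd: "bdd_below ((\<lambda>q. q x) ` C)" for x
        by (auto simp: bdd_below_def)
      have lower: "u x \<le> q x" if "q \<in> C" for q x
        unfolding u_def using bdd that by (rule cINF_lower)
      have greatest: "c \<le> u x" if "\<And>q. q \<in> C \<Longrightarrow> c \<le> q x" for c x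
        unfolding u_def using False that by (rule cINF_greatest)
      \<comment> \<open>The chain property is used here: the smaller of \<open>q\<close> and
        \<open>r\<close> can replace both.\<close>
      have add: "u (x + y) \<le> q x + r y" if "q \<in> C" "r \<in> C" for q r x y
      proof -
        obtain s where s: "s \<in> C" "s \<le> q" "s \<le> r"
          using C(2)[of q r] \<open>q \<in> C\<close> \<open>r \<in> C\<close> by blast
        have "u (x + y) \<le> s x + s y"
          using lower[OF s(1)] sublinear_functional_add[OF sub[OF s(1)]] order_trans by blast
        then show ?thesis
          using le_funD[OF s(2), of x] le_funD[OF s(3), of y] by linarith
      qed
      \<comment> \<open>Infima over the two members of the chain are taken one after the
        other.\<close>
      have "u (x + y) - q x \<le> u y" if "q \<in> C" for q x y
        by (rule greatest) (use add[OF that] in \<open>simp add: algebra_simps\<close>)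
      then have "u (x + y) - u y \<le> u x" for x y
        by (intro greatest) (simp add: algebra_simps)
      moreover have "u (c *\<^sub>R x) \<le> c * u x" if "c > 0" for c x
      proof -
        have "u (c *\<^sub>R x) / c \<le> q x" if "q \<in> C" for q
          using order_trans[OF lower[OF that] sublinear_functional_scale_le[OF sub[OF that] \<open>c > 0\<close>]]
            \<open>c > 0\<close> by (simp add: field_simps)
        then have "u (c *\<^sub>R x) / c \<le> u x"
          by (rule greatest)
        then show ?thesis
          using \<open>c > 0\<close> by (simp add: field_simps)
      qed
      ultimately have "sublinear_functional u"
        unfolding sublinear_functional_def by (simp add: algebra_simps)
      moreover have "u \<le> p"
      proof -
        obtain q where "q \<in> C"
          using False by blast
        then show ?thesis
          using lower le_p by (meson le_fun_def order_trans)
      qed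
      ultimately show ?thesis
        using lower by (auto simp: A_def le_fun_def)
    qed
  qed
  then obtain q where q: "q \<in> A" "\<And>r. r \<in> A \<Longrightarrow> r \<le> q \<Longrightarrow> r = q"
    by blast
  show thesis
  proof (rule that)
    fix r
    assume "sublinear_functional r" "r \<le> q"
    then show "r = q"
      using q order_trans by (auto simp: A_def)
  qed (use q in \<open>auto simp: A_def\<close>)
qed

text \<open>For fixed \<open>y\<close>, lowering \<open>q\<close> along the ray in direction
  \<open>y\<close> yields a sublinear \<open>r \<le> q\<close>, which minimality forces to equal
  \<open>q\<close>. The parameter \<open>t = 1\<close> then reads
  \<open>q x \<le> q (x + y) - q y\<close>, so \<open>q\<close> is superadditive as well as
  subadditive.\<close>

lemma minimal_sublinear_functional_linear:
  assumes q: "sublinear_functional q"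
    and minimal: "\<And>r. sublinear_functional r \<Longrightarrow> r \<le> q \<Longrightarrow> r = q"
  shows "linear q"
proof -
  have superadd: "q x + q y \<le> q (x + y)" for x y
  proof -
    define r where "r x = (INF t\<in>{0..}. q (x + t *\<^sub>R y) - t * q y)" for x
    have "- q (- x) \<le> q (x + t *\<^sub>R y) - t * q y" if "t \<ge> 0" for x t
      using sublinear_functional_add[OF q, of "x + t *\<^sub>R y" "- x"]
        sublinear_functional_scale[OF q that, of y] by simp
    then have bdd: "bdd_below ((\<lambda>t. q (x + t *\<^sub>R y) - t * q y) ` {0..})" for x
      by (auto simp: bdd_below_def)
    have lower: "r x \<le> q (x + t *\<^sub>R y) - t * q y" if "t \<ge> 0" for x t
      unfolding r_def by (rule cINF_lower) (use bdd that in auto)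
    have greatest: "c \<le> r x" if "\<And>t. t \<ge> 0 \<Longrightarrow> c \<le> q (x + t *\<^sub>R y) - t * q y" for c x
      unfolding r_def by (rule cINF_greatest) (use that in auto)
    \<comment> \<open>The ray parameters add up: \<open>s + t\<close> is an admissible parameter for
      \<open>x + z\<close>.\<close>
    have add: "r (x + z) \<le> (q (x + s *\<^sub>R y) - s * q y) + (q (z + t *\<^sub>R y) - t * q y)"
      if "s \<ge> 0" "t \<ge> 0" for x z s t
    proof -
      have "r (x + z) \<le> q ((x + z) + (s + t) *\<^sub>R y) - (s + t) * q y"
        using that by (intro lower) simp
      moreover have "q ((x + z) + (s + t) *\<^sub>R y) \<le> q (x + s *\<^sub>R y) + q (z + t *\<^sub>R y)"
        using sublinear_functional_add[OF q, of "x + s *\<^sub>R y" "z + t *\<^sub>R y"]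
        by (simp add: algebra_simps)
      ultimately show ?thesis
        by (simp add: algebra_simps)
    qed
    have "r (x + z) - (q (x + s *\<^sub>R y) - s * q y) \<le> r z" if "s \<ge> 0" for x z s
      by (rule greatest) (use add[OF that] in \<open>simp add: algebra_simps\<close>)
    then have "r (x + z) - r z \<le> r x" for x z
      by (intro greatest) (simp add: algebra_simps)
    moreover have "r (c *\<^sub>R x) \<le> c * r x" if "c > 0" for c x
    proof -
      have "r (c *\<^sub>R x) / c \<le> q (x + t *\<^sub>R y) - t * q y" if "t \<ge> 0" for t
      proof -
        have "r (c *\<^sub>R x) \<le> q (c *\<^sub>R x + (c * t) *\<^sub>R y) - (c * t) * q y"
          using \<open>c > 0\<close> that by (intro lower) simp
        also have "\<dots> = c * (q (x + t *\<^sub>R y) - t * q y)"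
          using sublinear_functional_scale[OF q, of c "x + t *\<^sub>R y"] \<open>c > 0\<close>
          by (simp add: algebra_simps)
        finally show ?thesis
          using \<open>c > 0\<close> by (simp add: field_simps)
      qed
      then have "r (c *\<^sub>R x) / c \<le> r x"
        by (rule greatest)
      then show ?thesis
        using \<open>c > 0\<close> by (simp add: field_simps)
    qed
    ultimately have "sublinear_functional r"
      unfolding sublinear_functional_def by (simp add: algebra_simps)
    moreover have "r \<le> q"
      using lower[of 0] by (simp add: le_fun_def)
    ultimately have "r = q"
      by (rule minimal)
    then show ?thesis
      using lower[of 1 x] by simp
  qed
  have add: "q (x + y) = q x + q y" for x y
    using superadd sublinear_functional_add[OF q] by (simp add: antisym)
  have minus: "q (- x) = - q x" for x
    using add[of x "- x"] sublinear_functional_zero[OF q] by simp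
  show ?thesis
  proof (rule linearI)
    fix c x
    show "q (c *\<^sub>R x) = c *\<^sub>R q x"
    proof (cases "c \<ge> 0")
      case False
      then have "q ((- c) *\<^sub>R x) = (- c) * q x"
        by (intro sublinear_functional_scale[OF q]) simp
      then show ?thesis
        by (simp add: minus)
    qed (simp add: sublinear_functional_scale[OF q])
  qed (rule add)
qed

lemma linear_below_sublinear_functional:
  assumes "sublinear_functional p"
  obtains \<phi> where "linear \<phi>" "\<And>x. \<phi> x \<le> p x"
  using assms minimal_sublinear_functional_exists minimal_sublinear_functional_linear
  by (metis le_funD)

text \<open>A linear \<open>\<phi>\<close> is placed below \<open>q x\<close>, the infimum of
  \<open>L k + \<epsilon> * norm (x + k)\<close> over the cone. The choice \<open>k = 0\<close>
  bounds \<open>\<phi>\<close> by \<open>\<epsilon>\<close> times the norm, and the point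
  \<open>x = - k\<close> gives \<open>\<phi> (- k) \<le> L k\<close>, so
  \<open>M = L + \<phi>\<close> is close to \<open>L\<close> and nonnegative on the cone.\<close>

lemma convex_cone_majorant:
  fixes L :: "'a::real_normed_vector \<Rightarrow>\<^sub>L real"
  assumes cone: "0 \<in> K" "\<And>x y. x \<in> K \<Longrightarrow> y \<in> K \<Longrightarrow> x + y \<in> K"
      "\<And>c x. c > 0 \<Longrightarrow> x \<in> K \<Longrightarrow> c *\<^sub>R x \<in> K"
    and lower: "\<And>k. k \<in> K \<Longrightarrow> - \<epsilon> * norm k \<le> L k" and "\<epsilon> \<ge> 0"
  obtains M :: "'a \<Rightarrow>\<^sub>L real"
  where "norm (L - M) \<le> \<epsilon>" "\<And>k. k \<in> K \<Longrightarrow> 0 \<le> M k"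
proof -
  define q where "q x = (INF k\<in>K. L k + \<epsilon> * norm (x + k))" for x
  \<comment> \<open>The hypothesis on \<open>L\<close> over \<open>K\<close> enters only here: it
    keeps the infimum \<open>q x\<close> finite.\<close>
  have "- \<epsilon> * norm x \<le> L k + \<epsilon> * norm (x + k)" if "k \<in> K" for x k
  proof -
    have "norm k \<le> norm x + norm (x + k)"
      using norm_triangle_ineq4[of "x + k" x] by simp
    then have "\<epsilon> * norm k \<le> \<epsilon> * norm x + \<epsilon> * norm (x + k)"
      using \<open>\<epsilon> \<ge> 0\<close> by (simp add: mult_left_mono flip: distrib_left)
    then show ?thesis
      using lower[OF that] by simp
  qed
  then have bdd: "bdd_below ((\<lambda>k. L k + \<epsilon> * norm (x + k)) ` K)" for x
    by (auto simp: bdd_below_def)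
  have lower_q: "q x \<le> L k + \<epsilon> * norm (x + k)" if "k \<in> K" for x k
    unfolding q_def using bdd that by (rule cINF_lower)
  have greatest: "c \<le> q x" if "\<And>k. k \<in> K \<Longrightarrow> c \<le> L k + \<epsilon> * norm (x + k)" for c x
    unfolding q_def by (rule cINF_greatest) (use cone that in auto)
  have add: "q (x + y) \<le> (L k + \<epsilon> * norm (x + k)) + (L l + \<epsilon> * norm (y + l))"
    if "k \<in> K" "l \<in> K" for x y k l
  proof -
    have "norm ((x + y) + (k + l)) \<le> norm (x + k) + norm (y + l)"
      using norm_triangle_ineq[of "x + k" "y + l"] by (simp add: algebra_simps)
    then have "\<epsilon> * norm ((x + y) + (k + l)) \<le> \<epsilon> * norm (x + k) + \<epsilon> * norm (y + l)"
      using \<open>\<epsilon> \<ge> 0\<close> by (simp add: mult_left_mono flip: distrib_left)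
    then show ?thesis
      using lower_q[of "k + l" "x + y"] cone(2)[OF that] by (simp add: blinfun.add_right)
  qed
  have "q (x + y) - (L k + \<epsilon> * norm (x + k)) \<le> q y" if "k \<in> K" for x y k
    by (rule greatest) (use add[OF that, of _ x y] in \<open>simp add: algebra_simps\<close>)
  then have "q (x + y) - q y \<le> q x" for x y
    by (intro greatest) (simp add: algebra_simps)
  moreover have "q (c *\<^sub>R x) \<le> c * q x" if "c > 0" for c x
  proof -
    have "q (c *\<^sub>R x) / c \<le> L k + \<epsilon> * norm (x + k)" if "k \<in> K" for k
    proof -
      have "q (c *\<^sub>R x) \<le> L (c *\<^sub>R k) + \<epsilon> * norm (c *\<^sub>R x + c *\<^sub>R k)"
        using cone(3)[OF \<open>c > 0\<close> that] by (rule lower_q)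
      also have "\<dots> = c * (L k + \<epsilon> * norm (x + k))"
        using \<open>c > 0\<close> by (simp add: blinfun.scaleR_right algebra_simps flip: scaleR_add_right)
      finally show ?thesis
        using \<open>c > 0\<close> by (simp add: field_simps)
    qed
    then have "q (c *\<^sub>R x) / c \<le> q x"
      by (rule greatest)
    then show ?thesis
      using \<open>c > 0\<close> by (simp add: field_simps)
  qed
  ultimately have "sublinear_functional q"
    unfolding sublinear_functional_def by (simp add: algebra_simps)
  then obtain \<phi> where \<phi>: "linear \<phi>" "\<And>x. \<phi> x \<le> q x"
    by (rule linear_below_sublinear_functional) blast
  have \<phi>_le: "\<phi> x \<le> \<epsilon> * norm x" for x
    using order_trans[OF \<phi>(2) lower_q[OF cone(1)]] by simp
  have \<phi>_abs: "\<bar>\<phi> x\<bar> \<le> \<epsilon> * norm x" for x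
    using \<phi>_le[of x] \<phi>_le[of "- x"] by (simp add: linear_neg[OF \<phi>(1)])
  have "bounded_linear \<phi>"
    using \<phi>(1) by (rule bounded_linear.intro) (use \<phi>_abs in \<open>auto simp: bounded_linear_axioms_def mult.commute\<close>)
  then have apply_\<phi>: "blinfun_apply (Blinfun \<phi>) = \<phi>"
    by (rule bounded_linear_Blinfun_apply)
  show thesis
  proof
    show "norm (L - (L + Blinfun \<phi>)) \<le> \<epsilon>"
      using \<phi>_abs \<open>\<epsilon> \<ge> 0\<close> by (auto intro: norm_blinfun_bound simp: apply_\<phi>)
    show "0 \<le> (L + Blinfun \<phi>) k" if "k \<in> K" for k
    proof -
      have "\<phi> (- k) \<le> L k"
        using order_trans[OF \<phi>(2) lower_q[OF that]] by (metis add.right_neutral left_minus mult_zero_right norm_zero)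
      then show ?thesis
        by (simp add: apply_\<phi> blinfun.add_left linear_neg[OF \<phi>(1)])
    qed
  qed
qed

section \<open>Dual families of independent functionals\<close>

text \<open>A Gram-Schmidt-like induction: \<open>P\<close> removes the components along the old
  vectors, so the old functionals vanish on its range, and a vector there on which the new
  functional is nonzero completes the family.\<close>

lemma dual_family_exists:
  fixes a :: "'i \<Rightarrow> ('x::real_normed_vector \<Rightarrow>\<^sub>L real)"
  assumes "finite I" "independent_family a I"
  obtains e where "\<And>i j. i \<in> I \<Longrightarrow> j \<in> I \<Longrightarrow> a i (e j) = (if i = j then 1 else 0)"
  using assms
proof (induction I arbitrary: thesis rule: finite_induct)
  case empty
  then show ?case
    by blast
next
  case (insert k I)
  have indep: "independent (insert (a k) (a ` I))" and "a k \<notin> a ` I" "inj_on a I"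
    using insert.prems(2) insert.hyps by (auto simp: independent_family_def inj_on_insert)
  then have notin: "a k \<notin> span (a ` I)" and "independent_family a I"
    by (auto simp: independent_insert independent_family_def)
  then obtain e where e: "\<And>i j. i \<in> I \<Longrightarrow> j \<in> I \<Longrightarrow> a i (e j) = (if i = j then 1 else 0)"
    using insert.IH by blast
  define P where "P x = x - (\<Sum>i\<in>I. a i x *\<^sub>R e i)" for x
  have aP: "a j (P x) = 0" if "j \<in> I" for j x
  proof -
    have "(\<Sum>i\<in>I. a i x * a j (e i)) = (\<Sum>i\<in>I. if i = j then a i x else 0)"
      by (rule sum.cong) (use that e in auto)
    then show ?thesis
      using that insert.hyps
      by (simp add: P_def blinfun.diff_right blinfun.sum_right blinfun.scaleR_right)
  qed
  \<comment> \<open>If \<open>a k\<close> vanished on the range of \<open>P\<close>, expanding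
    \<open>P x\<close> would exhibit it as a combination of the old functionals.\<close>
  have "\<exists>x. a k (P x) \<noteq> 0"
  proof (rule ccontr)
    assume "\<nexists>x. a k (P x) \<noteq> 0"
    then have kP: "a k (P x) = 0" for x
      by blast
    have "a k x = (\<Sum>i\<in>I. a k (e i) *\<^sub>R a i) x" for x
      using kP[of x]
      by (simp add: P_def blinfun.diff_right blinfun.sum_right blinfun.scaleR_right
          blinfun.sum_left blinfun.scaleR_left mult.commute)
    then have "a k = (\<Sum>i\<in>I. a k (e i) *\<^sub>R a i)"
      by (rule blinfun_eqI)
    moreover have "(\<Sum>i\<in>I. a k (e i) *\<^sub>R a i) \<in> span (a ` I)"
      by (intro span_sum span_scale span_base) auto
    ultimately show False
      using notin by simp
  qed
  then obtain x where x: "a k (P x) \<noteq> 0"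
    by blast
  define ek where "ek = (1 / a k (P x)) *\<^sub>R P x"
  \<comment> \<open>Since \<open>ek\<close> is annihilated by the old functionals, subtracting a
    multiple of it corrects only the value of \<open>a k\<close>.\<close>
  define e' where "e' j = (if j = k then ek else e j - a k (e j) *\<^sub>R ek)" for j
  have ek: "a k ek = 1" "\<And>i. i \<in> I \<Longrightarrow> a i ek = 0"
    using x by (simp_all add: ek_def blinfun.scaleR_right aP)
  show ?case
  proof (rule insert.prems(1))
    fix i j
    assume "i \<in> insert k I" "j \<in> insert k I"
    then show "a i (e' j) = (if i = j then 1 else 0)"
      using ek e insert.hyps
      by (auto simp: e'_def blinfun.diff_right blinfun.scaleR_right)
  qed
qed


section \<open>Continuously differentiable constraints and a Lyusternik-type curve\<close>

lemma differential_has_derivative: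
  "g differentiable (at u) \<Longrightarrow> (g has_derivative differential g u) (at u)"
  by (simp add: differential_def frechet_derivative_works bounded_linear_Blinfun_apply
      has_derivative_bounded_linear)

lemma C1_functional_differentiable: "C1_functional g \<Longrightarrow> g differentiable (at u)"
  by (simp add: C1_functional_def)

lemma C1_functional_continuous_on: "C1_functional g \<Longrightarrow> continuous_on A g"
  by (meson C1_functional_differentiable continuous_at_imp_continuous_on
      differentiable_imp_continuous_within)

text \<open>The function \<open>differential g v x - g x\<close> has derivative
  \<open>differential g v - differential g x\<close>, which is small near \<open>v\<close> by
  continuity; the mean value inequality on a ball turns this into a Lipschitz bound. It supplies the
  contraction for the curve below.\<close>

lemma C1_functional_remainder_lipschitz:
  assumes g: "C1_functional g" and "\<eta> > 0"
  shows "\<forall>\<^sub>F \<rho> in at_right 0. \<forall>y y'. norm y \<le> \<rho> \<longrightarrow> norm y' \<le> \<rho> \<longrightarrow>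
    \<bar>differential g v (y - y') - (g (v + y) - g (v + y'))\<bar> \<le> \<eta> * norm (y - y')"
proof -
  have "isCont (differential g) v"
    using g by (simp add: C1_functional_def continuous_on_eq_continuous_at)
  then have "\<exists>d>0. \<forall>x. dist x v < d \<longrightarrow> dist (differential g x) (differential g v) < \<eta>"
    using \<open>\<eta> > 0\<close> by (simp only: continuous_at_eps_delta)
  then obtain d where "d > 0"
    and d: "\<And>x. dist x v < d \<Longrightarrow> dist (differential g x) (differential g v) < \<eta>"
    by blast
  have *: "\<bar>differential g v (y - y') - (g (v + y) - g (v + y'))\<bar> \<le> \<eta> * norm (y - y')"
    if "\<rho> < d" "norm y \<le> \<rho>" "norm y' \<le> \<rho>" for \<rho> y y'
  proof -
    have "norm ((differential g v (v + y) - g (v + y)) - (differential g v (v + y') - g (v + y')))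
        \<le> \<eta> * norm ((v + y) - (v + y'))"
    proof (rule differentiable_bound[OF convex_cball[of v \<rho>]])
      fix x
      assume x: "x \<in> cball v \<rho>"
      have "(g has_derivative differential g x) (at x within cball v \<rho>)"
        by (rule has_derivative_at_withinI[OF differential_has_derivative[OF
            C1_functional_differentiable[OF g]]])
      then have "((\<lambda>x. differential g v x - g x) has_derivative
          (\<lambda>h. differential g v h - differential g x h)) (at x within cball v \<rho>)"
        by (intro derivative_intros) (simp add: blinfun.bounded_linear_right bounded_linear_imp_has_derivative)
      then show "((\<lambda>x. differential g v x - g x) has_derivative
          blinfun_apply (differential g v - differential g x)) (at x within cball v \<rho>)"
        by (simp add: blinfun.diff_left [abs_def])
      have "norm (differential g v - differential g x) \<le> \<eta>"
        using d[of x] x that by (auto simp: dist_norm norm_minus_commute)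
      then show "onorm (differential g v - differential g x) \<le> \<eta>"
        by (simp add: norm_blinfun.rep_eq)
    qed (use that in \<open>auto simp: dist_norm\<close>)
    then show ?thesis
      by (simp add: blinfun.diff_right blinfun.add_right algebra_simps)
  qed
  have "\<forall>\<^sub>F \<rho> in at_right 0. \<rho> < d"
    using \<open>d > 0\<close> eventually_at_right_field by blast
  then show ?thesis
    by (rule eventually_mono) (use * in blast)
qed

text \<open>The correction \<open>z\<close> is the fixed point of the contraction
  \<open>z \<mapsto> \<Sum>\<^sub>i (dG\<^sub>i(v)(th + z) - G\<^sub>i(v + th + z)) e\<^sub>i\<close>; applying \<open>dG\<^sub>i(v)\<close> to the fixed point equation
  gives the prescribed constraint values.\<close>

lemma curve_with_prescribed_constraint_values:
  fixes v :: "'x::banach"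
  assumes "finite I" and C1: "\<And>i. i \<in> I \<Longrightarrow> C1_functional (G i)"
    and zero: "\<And>i. i \<in> I \<Longrightarrow> G i v = 0"
    and dual: "\<And>i j. i \<in> I \<Longrightarrow> j \<in> I \<Longrightarrow> differential (G i) v (e j) = (if i = j then 1 else 0)"
    and "\<delta> > 0"
  shows "\<forall>\<^sub>F t in at_right 0. \<exists>z. norm z \<le> \<delta> * t \<and>
    (\<forall>i\<in>I. G i (v + (t *\<^sub>R h + z)) = t * differential (G i) v h)"
proof -
  \<comment> \<open>\<open>c\<close> is the contraction factor: \<open>1/2\<close> keeps it below 1,
    and the other term lets the ball of radius \<open>\<delta> * t\<close> be mapped into itself.
    The remainders need the Lipschitz constant \<open>\<eta>\<close> because the vectors
    \<open>e i\<close> contribute the factor \<open>N\<close>; \<open>N + 1\<close> avoids division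
    by zero.\<close>
  define c where "c = min (1/2) (\<delta> / (\<delta> + norm h))"
  define N where "N = (\<Sum>i\<in>I. norm (e i))"
  define \<eta> where "\<eta> = c / (N + 1)"
  have pos: "\<delta> + norm h > 0"
    using \<open>\<delta> > 0\<close> by (simp add: add_pos_nonneg)
  have c: "0 < c" "c < 1" "c * (\<delta> + norm h) \<le> \<delta>"
  proof -
    show "0 < c" "c < 1"
      using \<open>\<delta> > 0\<close> pos by (auto simp: c_def)
    have "c \<le> \<delta> / (\<delta> + norm h)"
      by (simp add: c_def)
    then show "c * (\<delta> + norm h) \<le> \<delta>"
      using pos by (simp add: pos_le_divide_eq)
  qed
  have "N \<ge> 0"
    by (simp add: N_def sum_nonneg)
  then have "\<eta> > 0" "\<eta> * N \<le> c"
    using c by (auto simp: \<eta>_def field_simps)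
  define r where "r i y = differential (G i) v y - G i (v + y)" for i y
  have "\<forall>\<^sub>F \<rho> in at_right 0. \<forall>i\<in>I. \<forall>y y'. norm y \<le> \<rho> \<longrightarrow> norm y' \<le> \<rho> \<longrightarrow>
      \<bar>r i y - r i y'\<bar> \<le> \<eta> * norm (y - y')"
    using C1_functional_remainder_lipschitz[OF C1 \<open>\<eta> > 0\<close>, of _ v]
    by (intro eventually_ball_finite \<open>finite I\<close> ballI)
      (simp add: r_def blinfun.diff_right algebra_simps)
  then have "\<forall>\<^sub>F \<rho> in at_right 0. \<rho> > 0 \<and> (\<forall>i\<in>I. \<forall>y y'. norm y \<le> \<rho> \<longrightarrow> norm y' \<le> \<rho> \<longrightarrow>
      \<bar>r i y - r i y'\<bar> \<le> \<eta> * norm (y - y'))"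
    by (intro eventually_conj) (auto simp: eventually_at_right_less)
  then obtain \<rho> where "\<rho> > 0" and \<rho>: "\<And>i y y'. i \<in> I \<Longrightarrow> norm y \<le> \<rho> \<Longrightarrow> norm y' \<le> \<rho> \<Longrightarrow>
      \<bar>r i y - r i y'\<bar> \<le> \<eta> * norm (y - y')"
    using eventually_happens'[OF trivial_limit_at_right_real] by blast
  \<comment> \<open>The bound on \<open>t\<close> keeps \<open>t *\<^sub>R h + z\<close> within
    radius \<open>\<rho>\<close>, where the remainders are Lipschitz.\<close>
  have solve: "\<exists>z. norm z \<le> \<delta> * t \<and> (\<forall>i\<in>I. G i (v + (t *\<^sub>R h + z)) = t * differential (G i) v h)"
    if t: "0 < t" "t < \<rho> / (\<delta> + norm h)" for t
  proof -
    define B where "B = cball (0::'x) (\<delta> * t)"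
    define T where "T z = (\<Sum>i\<in>I. r i (t *\<^sub>R h + z) *\<^sub>R e i)" for z
    have small: "norm (t *\<^sub>R h + z) \<le> t * (\<delta> + norm h)" if "z \<in> B" for z
      using norm_triangle_ineq[of "t *\<^sub>R h" z] that t by (simp add: B_def algebra_simps)
    have "t * (\<delta> + norm h) \<le> \<rho>"
      using t pos by (simp add: field_simps)
    have lip: "norm (\<Sum>i\<in>I. (r i y - r i y') *\<^sub>R e i) \<le> c * norm (y - y')"
      if "norm y \<le> \<rho>" "norm y' \<le> \<rho>" for y y'
    proof -
      have "norm (\<Sum>i\<in>I. (r i y - r i y') *\<^sub>R e i) \<le> (\<Sum>i\<in>I. (\<eta> * norm (y - y')) * norm (e i))"
        by (rule sum_norm_le) (use \<rho> that in \<open>auto intro: mult_right_mono\<close>)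
      also have "\<dots> = (\<eta> * N) * norm (y - y')"
        by (simp add: N_def sum_distrib_left mult_ac)
      also have "\<dots> \<le> c * norm (y - y')"
        using \<open>\<eta> * N \<le> c\<close> by (intro mult_right_mono) auto
      finally show ?thesis .
    qed
    have "\<exists>!z\<in>B. T z = z"
    proof (rule Banach_fix[of _ c])
      show "complete B" "B \<noteq> {}"
        using mult_pos_pos[OF \<open>\<delta> > 0\<close> t(1)] by (auto simp: B_def complete_eq_closed)
      show "T ` B \<subseteq> B"
      proof safe
        fix z
        assume z: "z \<in> B"
        \<comment> \<open>As \<open>v\<close> satisfies \<open>G i v = 0\<close>, the size of
          \<open>T z\<close> is itself a difference of remainders.\<close>
        have "r i 0 = 0" if "i \<in> I" for i
          using zero[OF that] by (simp add: r_def blinfun.zero_right)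
        then have "T z = (\<Sum>i\<in>I. (r i (t *\<^sub>R h + z) - r i 0) *\<^sub>R e i)"
          by (simp add: T_def)
        then have "norm (T z) \<le> c * norm (t *\<^sub>R h + z - 0)"
          using lip[of "t *\<^sub>R h + z" 0] small[OF z] \<open>t * (\<delta> + norm h) \<le> \<rho>\<close> \<open>\<rho> > 0\<close> by simp
        also have "\<dots> \<le> c * (t * (\<delta> + norm h))"
          using small[OF z] c by (intro mult_left_mono) auto
        also have "\<dots> \<le> \<delta> * t"
          using mult_left_mono[OF c(3), of t] t by (simp add: mult_ac)
        finally show "T z \<in> B"
          by (simp add: B_def)
      qed
      show "dist (T x) (T y) \<le> c * dist x y" if "x \<in> B" "y \<in> B" for x y
      proof -
        have "T x - T y = (\<Sum>i\<in>I. (r i (t *\<^sub>R h + x) - r i (t *\<^sub>R h + y)) *\<^sub>R e i)"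
          by (simp add: T_def sum_subtractf algebra_simps)
        then show ?thesis
          using lip[of "t *\<^sub>R h + x" "t *\<^sub>R h + y"] small[of x] small[of y] that
            \<open>t * (\<delta> + norm h) \<le> \<rho>\<close>
          by (simp add: dist_norm)
      qed
    qed (use c in auto)
    then obtain z where z: "z \<in> B" "T z = z"
      by blast
    have "G i (v + (t *\<^sub>R h + z)) = t * differential (G i) v h" if "i \<in> I" for i
    proof -
      have "differential (G i) v (T z) = (\<Sum>j\<in>I. if j = i then r j (t *\<^sub>R h + z) else 0)"
        unfolding T_def blinfun.sum_right
        by (rule sum.cong) (use that dual in \<open>auto simp: blinfun.scaleR_right\<close>)
      also have "\<dots> = r i (t *\<^sub>R h + z)"
        using \<open>finite I\<close> that by simp
      finally show ?thesis
        by (simp add: z r_def blinfun.add_right blinfun.scaleR_right)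
    qed
    then show ?thesis
      using z by (auto simp: B_def)
  qed
  have "\<rho> / (\<delta> + norm h) > 0"
    using \<open>\<rho> > 0\<close> pos by simp
  then show ?thesis
    unfolding eventually_at_right_field using solve by blast
qed

section \<open>Approximate first-order conditions and multipliers\<close>

text \<open>The direction \<open>h\<close> is followed along a curve that stays in the constraint
  set and deviates from the ray by at most \<open>\<delta> * t\<close>. Comparing \<open>f\<close>
  at both ends, cancelling \<open>t\<close> and letting \<open>\<delta>\<close> tend to 0 gives the
  inequality.\<close>

lemma constraint_set_directional_inequality:
  fixes v :: "'x::banach"
  assumes v: "v \<in> constraint_set G p m"
    and C1: "\<And>j. j \<in> {1..m} \<Longrightarrow> C1_functional (G j)" and "p \<le> m"
    and indep: "independent_family (\<lambda>j. differential (G j) v) (active_indices G m v)"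
    and f: "f differentiable (at v)" and "\<epsilon> \<ge> 0"
    and min: "\<And>z. z \<in> constraint_set G p m \<Longrightarrow> f v \<le> f z + \<epsilon> * dist v z"
    and eq: "\<And>j. j \<in> {1..p} \<Longrightarrow> differential (G j) v h = 0"
    and ineq: "\<And>j. j \<in> active_indices G m v \<Longrightarrow> 0 \<le> differential (G j) v h"
  shows "- \<epsilon> * norm h \<le> differential f v h"
proof -
  define I where "I = active_indices G m v"
  have I: "finite I" "\<And>i. i \<in> I \<Longrightarrow> i \<in> {1..m} \<and> G i v = 0"
    by (auto simp: I_def active_indices_def)
  obtain e where dual: "\<And>i j. i \<in> I \<Longrightarrow> j \<in> I \<Longrightarrow> differential (G i) v (e j) = (if i = j then 1 else 0)"
    using dual_family_exists[OF I(1) indep[folded I_def]] by blast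
  \<comment> \<open>One \<open>\<delta>\<close> controls both the deviation of the curve and the
    linearization error of \<open>f\<close>; the last bracket collects the resulting error
    terms.\<close>
  have "0 \<le> (differential f v h + \<epsilon> * norm h)
      + \<delta> * (norm (differential f v) + norm h + \<delta> + \<epsilon>)" if "\<delta> > 0" for \<delta>
  proof -
    have curve: "\<forall>\<^sub>F t in at_right 0. \<exists>z. norm z \<le> \<delta> * t \<and>
        (\<forall>i\<in>I. G i (v + (t *\<^sub>R h + z)) = t * differential (G i) v h)"
      using I C1 dual \<open>\<delta> > 0\<close> by (intro curve_with_prescribed_constraint_values[of I G v e]) auto
    obtain d where "d > 0" and d0: "\<forall>y. norm (y - v) < d \<longrightarrow>
        norm (f y - f v - differential f v (y - v)) \<le> \<delta> * norm (y - v)"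
      using differential_has_derivative[OF f] \<open>\<delta> > 0\<close> unfolding has_derivative_at_alt by blast
    have d: "\<bar>f (v + y) - f v - differential f v y\<bar> \<le> \<delta> * norm y" if "norm y < d" for y
      using d0[rule_format, of "v + y"] that by simp
    \<comment> \<open>The curve controls only the active constraints; the inactive inequalities are
      strict at \<open>v\<close> and persist nearby by continuity.\<close>
    have "\<forall>\<^sub>F y in nhds v. \<forall>j\<in>{1..m} - I. G j v > 0 \<longrightarrow> G j y > 0"
    proof (intro eventually_ball_finite ballI)
      fix j
      assume j: "j \<in> {1..m} - I"
      then have "isCont (G j) v"
        using C1 C1_functional_differentiable differentiable_imp_continuous_within by blast
      then have "(G j \<longlongrightarrow> G j v) (nhds v)"
        by (simp add: continuous_at tendsto_at_iff_tendsto_nhds)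
      then show "\<forall>\<^sub>F y in nhds v. G j v > 0 \<longrightarrow> G j y > 0"
        by (cases "G j v > 0") (auto dest: order_tendstoD)
    qed simp
    then obtain d' where "d' > 0" and d0': "\<forall>y. dist y v < d' \<longrightarrow>
        (\<forall>j\<in>{1..m} - I. G j v > 0 \<longrightarrow> G j y > 0)"
      unfolding eventually_nhds_metric by blast
    have d': "G j (v + y) > 0" if "norm y < d'" "j \<in> {1..m} - I" "G j v > 0" for y j
      using d0'[rule_format, of "v + y" j] that by (simp add: dist_norm)
    have "((\<lambda>t. t * (norm h + \<delta>)) \<longlongrightarrow> 0 * (norm h + \<delta>)) (at_right 0)"
      by (intro tendsto_intros)
    then have small: "\<forall>\<^sub>F t in at_right (0::real). t * (norm h + \<delta>) < min d d'"
      by (rule order_tendstoD) (use \<open>d > 0\<close> \<open>d' > 0\<close> in simp)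
    have "\<forall>\<^sub>F t in at_right (0::real). t > 0"
      by (simp add: eventually_at_right_less)
    with curve small have "\<forall>\<^sub>F t in at_right 0. t > 0 \<and> t * (norm h + \<delta>) < min d d' \<and> (\<exists>z. norm z \<le> \<delta> * t \<and>
        (\<forall>i\<in>I. G i (v + (t *\<^sub>R h + z)) = t * differential (G i) v h))"
      by eventually_elim blast
    then obtain t z where t: "t > 0" "t * (norm h + \<delta>) < d" "t * (norm h + \<delta>) < d'"
      and z: "norm z \<le> \<delta> * t" "\<And>i. i \<in> I \<Longrightarrow> G i (v + (t *\<^sub>R h + z)) = t * differential (G i) v h"
      by (auto dest!: eventually_happens'[OF trivial_limit_at_right_real])
    define y where "y = t *\<^sub>R h + z"
    have y: "norm y \<le> t * (norm h + \<delta>)"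
      using norm_triangle_ineq[of "t *\<^sub>R h" z] z t by (simp add: y_def algebra_simps)
    have "v + y \<in> constraint_set G p m"
    proof -
      have "G j (v + y) = 0" if "j \<in> {1..p}" for j
      proof -
        have "j \<in> I"
          using that v \<open>p \<le> m\<close> by (auto simp: I_def active_indices_def constraint_set_def)
        then show ?thesis
          using z(2) eq that by (simp add: y_def)
      qed
      moreover have "G j (v + y) \<ge> 0" if j: "j \<in> {p+1..m}" for j
      proof (cases "j \<in> I")
        case True
        then show ?thesis
          using z(2) ineq t by (simp add: y_def I_def)
      next
        case False
        then have "G j v > 0"
          using v j by (force simp: I_def active_indices_def constraint_set_def)
        then show ?thesis
          using d'[of y j] y t False j by force
      qed
      ultimately show ?thesis
        by (auto simp: constraint_set_def)
    qed
    then have "f v \<le> f (v + y) + \<epsilon> * norm y"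
      using min[of "v + y"] by (simp add: dist_norm)
    moreover have "f (v + y) - f v - differential f v y \<le> \<delta> * norm y"
      using d[of y] y t by simp
    moreover have "differential f v y \<le> t * differential f v h + norm (differential f v) * (\<delta> * t)"
    proof -
      have "differential f v z \<le> norm (differential f v) * norm z"
        using norm_blinfun[of "differential f v" z] by simp
      also have "\<dots> \<le> norm (differential f v) * (\<delta> * t)"
        using z by (intro mult_left_mono) auto
      finally show ?thesis
        by (simp add: y_def blinfun.add_right blinfun.scaleR_right)
    qed
    moreover have "\<epsilon> * norm y \<le> \<epsilon> * (t * (norm h + \<delta>))" "\<delta> * norm y \<le> \<delta> * (t * (norm h + \<delta>))"
      using y \<open>\<epsilon> \<ge> 0\<close> \<open>\<delta> > 0\<close> by (auto intro: mult_left_mono)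
    ultimately have "0 \<le> t * differential f v h + norm (differential f v) * (\<delta> * t)
        + \<epsilon> * (t * (norm h + \<delta>)) + \<delta> * (t * (norm h + \<delta>))"
      by linarith
    also have "\<dots> = t * ((differential f v h + \<epsilon> * norm h)
      + \<delta> * (norm (differential f v) + norm h + \<delta> + \<epsilon>))"
      by (simp add: algebra_simps)
    finally show ?thesis
      using t by (simp add: zero_le_mult_iff)
  qed
  then have "\<forall>\<^sub>F \<delta> in at_right 0. 0 \<le> (differential f v h + \<epsilon> * norm h)
      + \<delta> * (norm (differential f v) + norm h + \<delta> + \<epsilon>)"
    by (auto simp: eventually_at_right_field intro: exI[of _ 1])
  moreover have "((\<lambda>\<delta>. (differential f v h + \<epsilon> * norm h)
      + \<delta> * (norm (differential f v) + norm h + \<delta> + \<epsilon>)) \<longlongrightarrow>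
      (differential f v h + \<epsilon> * norm h) + 0 * (norm (differential f v) + norm h + 0 + \<epsilon>)) (at_right 0)"
    by (intro tendsto_intros)
  ultimately have "0 \<le> (differential f v h + \<epsilon> * norm h) + 0 * (norm (differential f v) + norm h + 0 + \<epsilon>)"
    by (intro tendsto_lowerbound) auto
  then show ?thesis
    by simp
qed

text \<open>The linearized cone \<open>K\<close> meets the hypotheses of
  \<open>convex_cone_majorant\<close>, and the resulting \<open>M\<close> is expanded in the active
  differentials. Its coefficients \<open>M (e j)\<close> are the multipliers.\<close>

lemma approximate_multipliers:
  fixes v :: "'x::banach"
  assumes v: "v \<in> constraint_set G p m"
    and C1: "\<And>j. j \<in> {1..m} \<Longrightarrow> C1_functional (G j)" and "p \<le> m"
    and indep: "independent_family (\<lambda>j. differential (G j) v) (active_indices G m v)"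
    and f: "f differentiable (at v)" and "\<epsilon> \<ge> 0"
    and min: "\<And>z. z \<in> constraint_set G p m \<Longrightarrow> f v \<le> f z + \<epsilon> * dist v z"
  obtains \<mu> :: "nat \<Rightarrow> real" where "\<And>j. j \<in> {p+1..m} \<Longrightarrow> \<mu> j \<ge> 0"
    "\<And>j. j \<in> {1..m} \<Longrightarrow> G j v \<noteq> 0 \<Longrightarrow> \<mu> j = 0"
    "norm (differential f v - (\<Sum>j=1..m. \<mu> j *\<^sub>R differential (G j) v)) \<le> \<epsilon>"
proof -
  define I where "I = active_indices G m v"
  define a where "a j = differential (G j) v" for j
  define K where "K = {h. (\<forall>j\<in>{1..p}. a j h = 0) \<and> (\<forall>j\<in>I. 0 \<le> a j h)}"
  have I: "finite I" "I \<subseteq> {1..m}"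
    by (auto simp: I_def active_indices_def)
  have "{1..p} \<subseteq> I"
    using v \<open>p \<le> m\<close> by (auto simp: I_def active_indices_def constraint_set_def)
  obtain e where dual: "\<And>i j. i \<in> I \<Longrightarrow> j \<in> I \<Longrightarrow> a i (e j) = (if i = j then 1 else 0)"
    using dual_family_exists[OF I(1) indep[folded I_def]] unfolding a_def by blast
  obtain M where M: "norm (differential f v - M) \<le> \<epsilon>" "\<And>k. k \<in> K \<Longrightarrow> 0 \<le> M k"
  proof (rule convex_cone_majorant[of K \<epsilon> "differential f v"])
    show "- \<epsilon> * norm k \<le> differential f v k" if "k \<in> K" for k
      by (rule constraint_set_directional_inequality[OF v C1 \<open>p \<le> m\<close> indep f \<open>\<epsilon> \<ge> 0\<close> min])
        (use that in \<open>auto simp: K_def I_def a_def\<close>)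
  qed (use \<open>\<epsilon> \<ge> 0\<close> in \<open>auto simp: K_def blinfun.add_right blinfun.scaleR_right blinfun.zero_right\<close>)
  define \<mu> where "\<mu> j = (if j \<in> I then M (e j) else 0)" for j
  have "M x = (\<Sum>j\<in>I. M (e j) *\<^sub>R a j) x" for x
  proof -
    \<comment> \<open>Removing the dual components leaves a vector on which all active differentials
      vanish. It lies in \<open>K\<close> together with its negative, so \<open>M\<close> vanishes
      on it.\<close>
    define x' where "x' = x - (\<Sum>j\<in>I. a j x *\<^sub>R e j)"
    have "a i x' = 0" if "i \<in> I" for i
    proof -
      have "(\<Sum>j\<in>I. a j x * a i (e j)) = (\<Sum>j\<in>I. if j = i then a j x else 0)"
        by (rule sum.cong) (use that dual in auto)
      then show ?thesis
        using that I
        by (simp add: x'_def blinfun.diff_right blinfun.sum_right blinfun.scaleR_right)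
    qed
    then have "x' \<in> K" "- x' \<in> K"
      using \<open>{1..p} \<subseteq> I\<close> by (auto simp: K_def blinfun.minus_right)
    then have "M x' = 0"
      using M(2)[of x'] M(2)[of "- x'"] by (simp add: blinfun.minus_right)
    then show ?thesis
      by (simp add: x'_def blinfun.diff_right blinfun.sum_right blinfun.scaleR_right
          blinfun.sum_left blinfun.scaleR_left mult.commute)
  qed
  then have "M = (\<Sum>j\<in>I. M (e j) *\<^sub>R a j)"
    by (rule blinfun_eqI)
  also have "\<dots> = (\<Sum>j=1..m. \<mu> j *\<^sub>R a j)"
    by (rule sum.mono_neutral_cong_left) (use I in \<open>auto simp: \<mu>_def\<close>)
  finally have M_eq: "M = (\<Sum>j=1..m. \<mu> j *\<^sub>R a j)" .
  show thesis
  proof (rule that)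
    show "\<mu> j \<ge> 0" if "j \<in> {p+1..m}" for j
    proof (cases "j \<in> I")
      case True
      \<comment> \<open>Since \<open>j > p\<close>, the dual vector is annihilated by every equality
        constraint, and its values on the active differentials are 0 or 1.\<close>
      then have "e j \<in> K"
        using dual that \<open>{1..p} \<subseteq> I\<close> by (auto simp: K_def subset_eq)
      then show ?thesis
        using M(2) True by (simp add: \<mu>_def)
    qed (simp add: \<mu>_def)
    show "\<mu> j = 0" if "j \<in> {1..m}" "G j v \<noteq> 0" for j
      using that by (simp add: \<mu>_def I_def active_indices_def)
    show "norm (differential f v - (\<Sum>j=1..m. \<mu> j *\<^sub>R differential (G j) v)) \<le> \<epsilon>"
      using M(1) M_eq by (simp add: a_def)
  qed
qed

lemma closed_constraint_set:
  assumes "\<And>j. j \<in> {1..m} \<Longrightarrow> continuous_on UNIV (G j)" "p \<le> m"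
  shows "closed (constraint_set G p m)"
proof -
  have "constraint_set G p m = (\<Inter>j\<in>{1..p}. {u. G j u = 0}) \<inter> (\<Inter>j\<in>{p+1..m}. {u. 0 \<le> G j u})"
    by (auto simp: constraint_set_def)
  also have "closed \<dots>"
    using assms by (intro closed_Int closed_INT ballI closed_Collect_eq closed_Collect_le) auto
  finally show ?thesis .
qed

section \<open>Polarization and symmetrization\<close>

context symmetrization_framework
begin

text \<open>One sequence of polarizers serves all points of \<open>S\<close>, so both points can be
  iterated with the same polarizers and the nonexpansive bound passes to the limit.\<close>

lemma star_nonexpansive:
  assumes "u \<in> S" "v \<in> S"
  shows "norm (\<iota> (star u) - \<iota> (star v)) \<le> norm (\<iota> u - \<iota> v)"
proof -
  obtain H where H: "\<And>n. n \<ge> 1 \<Longrightarrow> H n \<in> topspace \<H>"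
    and lim: "\<And>u. u \<in> S \<Longrightarrow> (\<lambda>n. \<iota> (iter_pol pol H n u)) \<longlonglongrightarrow> \<iota> (star u)"
    using iter_pol_tendsto by blast
  have iter_in: "iter_pol pol H n w \<in> S" if "w \<in> S" for w n
    by (induction n) (use that H pol_in in auto)
  have "norm (\<iota> (iter_pol pol H n u) - \<iota> (iter_pol pol H n v)) \<le> norm (\<iota> u - \<iota> v)" for n
  proof (induction n)
    case (Suc n)
    then show ?case
      using pol_nonexpansive[OF iter_in[OF assms(1)] iter_in[OF assms(2)], of "H (Suc n)" n n] H
      by (auto intro: order_trans)
  qed simp
  then show ?thesis
    by (intro LIMSEQ_le_const2[OF tendsto_norm[OF tendsto_diff[OF lim[OF assms(1)] lim[OF assms(2)]]]]) blast
qed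

lemma star_ext_lipschitz:
  "norm (\<iota> (star_ext star \<Theta> u) - \<iota> (star_ext star \<Theta> v)) \<le> C\<^sub>\<Theta> * norm (\<iota> u - \<iota> v)"
  using star_nonexpansive[OF \<Theta>_in \<Theta>_in] \<Theta>_lipschitz order_trans unfolding star_ext_def by blast

text \<open>The iterates of \<open>\<xi>\<close> stay in \<open>A \<inter> S\<close>, do not
  increase \<open>f\<close> and share the symmetrization \<open>star \<xi>\<close>; their
  convergence to it in \<open>V\<close> therefore makes a late iterate close to its own
  symmetrization.\<close>

lemma almost_symmetric_by_polarization:
  assumes invariant: "\<And>u H. u \<in> A \<inter> S \<Longrightarrow> H \<in> topspace \<H> \<Longrightarrow> pol u H \<in> A \<and> f (pol u H) \<le> f u"
    and "\<xi> \<in> A \<inter> S" and "\<epsilon> > 0"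
  obtains w where "w \<in> A \<inter> S" "f w \<le> (f \<xi> :: real)" "norm (\<iota> w - \<iota> (star w)) < \<epsilon>"
proof -
  obtain H where H: "\<And>n. n \<ge> 1 \<Longrightarrow> H n \<in> topspace \<H>"
    and lim: "(\<lambda>n. \<iota> (iter_pol pol H n \<xi>)) \<longlonglongrightarrow> \<iota> (star \<xi>)"
    using iter_pol_tendsto assms(2) by blast
  have iter: "iter_pol pol H n \<xi> \<in> A \<inter> S \<and> f (iter_pol pol H n \<xi>) \<le> f \<xi> \<and>
      star (iter_pol pol H n \<xi>) = star \<xi>" for n
  proof (induction n)
    case (Suc n)
    have "H (Suc n) \<in> topspace \<H>"
      using H by simp
    then show ?case
      using Suc invariant[of "iter_pol pol H n \<xi>" "H (Suc n)"] pol_in star_pol by force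
  qed (use assms(2) in simp)
  obtain n where "norm (\<iota> (iter_pol pol H n \<xi>) - \<iota> (star \<xi>)) < \<epsilon>"
    using LIMSEQ_D[OF lim \<open>\<epsilon> > 0\<close>] by blast
  then show thesis
    using that[of "iter_pol pol H n \<xi>"] iter[of n] by simp
qed

end

section \<open>Almost symmetric approximate critical points\<close>

theorem mainTheorem9:
  fixes \<iota> :: "'x::banach \<Rightarrow> 'v::banach"
    and \<kappa> :: "'v \<Rightarrow> 'w::banach"
    and S :: "'x set"
    and \<H> :: "'h topology"
    and pol :: "'x \<Rightarrow> 'h \<Rightarrow> 'x"
    and star \<Theta> :: "'x \<Rightarrow> 'x"
    and C\<^sub>\<Theta> :: real
    and G :: "nat \<Rightarrow> 'x \<Rightarrow> real"
    and m p :: nat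
    and f :: "'x \<Rightarrow> real"
    and \<C> :: "'x set"
  defines "\<C> \<equiv> constraint_set G p m"
  assumes framework: "symmetrization_framework \<iota> \<kappa> S \<H> pol star \<Theta> C\<^sub>\<Theta>"
    and G_C1: "\<And>j. j \<in> {1..m} \<Longrightarrow> C1_functional (G j)"
    and p: "1 \<le> p" "p \<le> m"
    and f_diff: "\<And>u. f differentiable (at u)"
    and inf_gt: "- \<infinity> < (INF u\<in>\<C>. ereal (f u))"
    and inf_lt: "(INF u\<in>\<C>. ereal (f u)) < \<infinity>"
    and reduce: "\<And>u. u \<in> \<C> \<Longrightarrow> \<exists>\<xi>\<in>\<C> \<inter> S. f \<xi> \<le> f u"
    and indep: "\<And>u. u \<in> \<C> \<Longrightarrow>
      independent_family (\<lambda>j. differential (G j) u) (active_indices G m u)"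
    and polarize: "\<And>u H. u \<in> \<C> \<inter> S \<Longrightarrow> H \<in> topspace \<H> \<Longrightarrow>
      pol_ext pol \<Theta> u H \<in> \<C> \<and> f (pol_ext pol \<Theta> u H) \<le> f u"
  shows "\<exists>C>0. \<forall>\<epsilon>>0. \<exists>u\<in>\<C>.
      ereal (f u) \<le> (INF v\<in>\<C>. ereal (f v)) + ereal (\<epsilon>\<^sup>2) \<and>
      norm (\<iota> u - \<iota> (star_ext star \<Theta> u)) < C * \<epsilon> \<and>
      (\<exists>\<mu> :: nat \<Rightarrow> real.
         (\<forall>j\<in>{p+1..m}. \<mu> j \<ge> 0) \<and>
         (\<forall>j\<in>{1..m}. G j u \<noteq> 0 \<longrightarrow> \<mu> j = 0) \<and>
         norm (differential f u - (\<Sum>j=1..m. \<mu> j *\<^sub>R differential (G j) u)) \<le> \<epsilon>)"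
proof -
  interpret symmetrization_framework \<iota> \<kappa> S \<H> pol star \<Theta> C\<^sub>\<Theta>
    by (rule framework)
  interpret \<iota>: bounded_linear \<iota>
    by (rule embed_XV(1))
  \<comment> \<open>\<open>K\<close> bounds the embedding into \<open>V\<close> and converts the
    \<open>X\<close>-distance of Ekeland's principle into a \<open>V\<close>-distance.\<close>
  obtain K where "K > 0" and K: "\<And>x. norm (\<iota> x) \<le> norm x * K"
    using \<iota>.pos_bounded by blast
  \<comment> \<open>Finiteness from above says that \<open>\<C>\<close> is nonempty.\<close>
  obtain b where b: "(INF u\<in>\<C>. ereal (f u)) = ereal b"
    using inf_gt inf_lt by (cases "INF u\<in>\<C>. ereal (f u)") auto
  have b_le: "b \<le> f u" if "u \<in> \<C>" for u
    using INF_lower[OF that, of "\<lambda>u. ereal (f u)"] b by simp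
  have closed: "closed \<C>"
    unfolding \<C>_def using G_C1 p by (intro closed_constraint_set C1_functional_continuous_on)
  have cont: "continuous_on \<C> f"
    using f_diff by (meson continuous_at_imp_continuous_on differentiable_imp_continuous_within)
  \<comment> \<open>In the constant, \<open>K\<close> accounts for the move from \<open>w\<close> to
    \<open>v\<close>, \<open>K * C\<^sub>\<Theta>\<close> for the induced move of the
    symmetrization, and 1 for the asymmetry of \<open>w\<close>.\<close>
  have main: "\<exists>u\<in>\<C>. f u \<le> b + \<epsilon>\<^sup>2 \<and>
      norm (\<iota> u - \<iota> (star_ext star \<Theta> u)) < (K * (1 + C\<^sub>\<Theta>) + 1) * \<epsilon> \<and>
      (\<exists>\<mu> :: nat \<Rightarrow> real.
         (\<forall>j\<in>{p+1..m}. \<mu> j \<ge> 0) \<and>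
         (\<forall>j\<in>{1..m}. G j u \<noteq> 0 \<longrightarrow> \<mu> j = 0) \<and>
         norm (differential f u - (\<Sum>j=1..m. \<mu> j *\<^sub>R differential (G j) u)) \<le> \<epsilon>)"
    if "\<epsilon> > 0" for \<epsilon> :: real
  proof -
    have "(INF u\<in>\<C>. ereal (f u)) < ereal (b + \<epsilon>\<^sup>2)"
      using b \<open>\<epsilon> > 0\<close> by simp
    then obtain u0 where "u0 \<in> \<C>" "f u0 < b + \<epsilon>\<^sup>2"
      by (auto simp: INF_less_iff)
    then obtain \<xi> where \<xi>: "\<xi> \<in> \<C> \<inter> S" "f \<xi> \<le> b + \<epsilon>\<^sup>2"
      using reduce by force
    have "pol u H \<in> \<C> \<and> f (pol u H) \<le> f u" if "u \<in> \<C> \<inter> S" "H \<in> topspace \<H>" for u H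
      using polarize[OF that] that by (simp add: pol_ext_def \<Theta>_id)
    then obtain w where w: "w \<in> \<C> \<inter> S" "f w \<le> f \<xi>" "norm (\<iota> w - \<iota> (star w)) < \<epsilon>"
      using almost_symmetric_by_polarization[of \<C> f \<xi> \<epsilon>] \<xi>(1) \<open>\<epsilon> > 0\<close> by blast
    have "bdd_below (f ` \<C>)"
      using b_le by (auto simp: bdd_below_def)
    then obtain v where v: "v \<in> \<C>" "f v + \<epsilon> * dist w v \<le> f w"
      and min: "\<And>z. z \<in> \<C> \<Longrightarrow> f v \<le> f z + \<epsilon> * dist v z"
      using ekeland_variational_principle[OF closed cont _ _ \<open>\<epsilon> > 0\<close>, of w] w(1) by blast
    \<comment> \<open>Both \<open>f w\<close> and \<open>f v\<close> lie between \<open>b\<close>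
      and \<open>b + \<epsilon>\<^sup>2\<close>, so the slope \<open>\<epsilon>\<close> allows a
      move of length at most \<open>\<epsilon>\<close>.\<close>
    have "\<epsilon> * dist w v \<le> \<epsilon> * \<epsilon>"
      using v(2) w(2) \<xi>(2) b_le[OF v(1)] by (simp add: power2_eq_square)
    then have "dist w v \<le> \<epsilon>"
      using \<open>\<epsilon> > 0\<close> by simp
    have "norm (\<iota> v - \<iota> w) \<le> norm (v - w) * K"
      using K[of "v - w"] by (simp add: \<iota>.diff)
    also have "\<dots> \<le> \<epsilon> * K"
      using \<open>dist w v \<le> \<epsilon>\<close> \<open>K > 0\<close> by (intro mult_right_mono) (auto simp: dist_norm norm_minus_commute)
    finally have near: "norm (\<iota> v - \<iota> w) \<le> \<epsilon> * K" .
    have "norm (\<iota> (star_ext star \<Theta> w) - \<iota> (star_ext star \<Theta> v)) \<le> C\<^sub>\<Theta> * (\<epsilon> * K)"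
      using star_ext_lipschitz[of w v] near C\<^sub>\<Theta>_pos
      by (smt (verit) mult_left_mono norm_minus_commute)
    moreover have "norm (\<iota> w - \<iota> (star_ext star \<Theta> w)) < \<epsilon>"
      using w by (simp add: star_ext_def \<Theta>_id)
    moreover have "norm (\<iota> v - \<iota> (star_ext star \<Theta> v)) \<le> norm (\<iota> v - \<iota> w)
        + norm (\<iota> w - \<iota> (star_ext star \<Theta> w))
        + norm (\<iota> (star_ext star \<Theta> w) - \<iota> (star_ext star \<Theta> v))"
      by norm
    ultimately have "norm (\<iota> v - \<iota> (star_ext star \<Theta> v)) < (K * (1 + C\<^sub>\<Theta>) + 1) * \<epsilon>"
      using near by (simp add: algebra_simps)
    moreover have "f v \<le> b + \<epsilon>\<^sup>2"
      using v(2) w(2) \<xi>(2) \<open>\<epsilon> > 0\<close> by (smt (verit) mult_nonneg_nonneg zero_le_dist)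
    moreover obtain \<mu> :: "nat \<Rightarrow> real" where "\<And>j. j \<in> {p+1..m} \<Longrightarrow> \<mu> j \<ge> 0"
      "\<And>j. j \<in> {1..m} \<Longrightarrow> G j v \<noteq> 0 \<Longrightarrow> \<mu> j = 0"
      "norm (differential f v - (\<Sum>j=1..m. \<mu> j *\<^sub>R differential (G j) v)) \<le> \<epsilon>"
      using approximate_multipliers[OF v(1)[unfolded \<C>_def] G_C1 p(2) indep[OF v(1)] f_diff
          less_imp_le[OF \<open>\<epsilon> > 0\<close>] min[unfolded \<C>_def]] by blast
    ultimately show ?thesis
      using v(1) by blast
  qed
  show ?thesis
  proof (intro exI conjI allI impI)
    show "K * (1 + C\<^sub>\<Theta>) + 1 > 0"
      using \<open>K > 0\<close> C\<^sub>\<Theta>_pos by (simp add: add_pos_pos)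
  qed (use main b in simp)
qed

end
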